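(* The $\mathbb F$-algebra homomorphism $\phi:\mathcal O\to\Delta$ that sends $X\mapsto A$ and $Y\mapsto B$ is not injective.
   Context: Let $\mathbb F$ be a field and fix a nonzero $q\in\mathbb F$ with $q^4\neq 1$; $[3]_q=q^2+1+q^{-2}$. The universal Askey--Wilson algebra $\Delta$ is the associative $\mathbb F$-algebra with 1 with generators $A,B,C$ subject to the relations that each of $A+\frac{qBC-q^{-1}CB}{q^2-q^{-2}}$, $B+\frac{qCA-q^{-1}AC}{q^2-q^{-2}}$, $C+\frac{qAB-q^{-1}BA}{q^2-q^{-2}}$ is central. The $q$-Onsager algebra $\mathcal O$ is the $\mathbb F$-algebra with generators $X,Y$ and relations $X^3Y-[3]_q X^2YX+[3]_q XYX^2-YX^3 = -(q^2-q^{-2})^2(XY-YX)$ and $Y^3X-[3]_q Y^2XY+[3]_q YXY^2-XY^3 = -(q^2-q^{-2})^2(YX-XY)$. (The homomorphism $\phi$ exists since $A,B$ satisfy these relations in $\Delta$.) *)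

theory Defs
  imports Main "HOL-Library.Poly_Mapping"
begin

text \<open>Words over an alphabet 'v form the free monoid; we write the monoid
operation (concatenation) additively so that Poly_Mapping's convolution
product makes the poly_mapping type from words to 'k the free associative 'k-algebra on 'v.\<close>

typedef 'v word = "UNIV :: 'v list set" by simp

setup_lifting type_definition_word

instantiation word :: (type) monoid_add
begin
lift_definition zero_word :: "'v word" is "[]" .
lift_definition plus_word :: "'v word \<Rightarrow> 'v word \<Rightarrow> 'v word" is "(@)" .
instance by standard (transfer; simp)+
end

type_synonym ('v, 'k) free_alg = "'v word \<Rightarrow>\<^sub>0 'k"

lift_definition letter :: "'v \<Rightarrow> 'v word" is "\<lambda>v. [v]" .

definition gen :: "'v \<Rightarrow> ('v, 'k::field) free_alg" where
  "gen v = Poly_Mapping.single (letter v) 1"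

definition scal :: "'k::field \<Rightarrow> ('v, 'k) free_alg" where
  "scal c = Poly_Mapping.single 0 c"

lift_definition word_eval :: "('v \<Rightarrow> 'a::monoid_mult) \<Rightarrow> 'v word \<Rightarrow> 'a"
  is "\<lambda>f w. foldr (\<lambda>v acc. f v * acc) w 1" .

definition subst_hom :: "('v \<Rightarrow> ('w, 'k::field) free_alg) \<Rightarrow> ('v, 'k) free_alg \<Rightarrow> ('w, 'k) free_alg" where
  "subst_hom f p = (\<Sum>w\<in>Poly_Mapping.keys p. scal (Poly_Mapping.lookup p w) * word_eval f w)"

inductive_set ideal_gen :: "'a::ring_1 set \<Rightarrow> 'a set" for S where
  base: "s \<in> S \<Longrightarrow> s \<in> ideal_gen S"
| zero: "0 \<in> ideal_gen S"
| add: "a \<in> ideal_gen S \<Longrightarrow> b \<in> ideal_gen S \<Longrightarrow> a + b \<in> ideal_gen S"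
| mult: "a \<in> ideal_gen S \<Longrightarrow> r * a * t \<in> ideal_gen S"

datatype ovar = X | Y
datatype awvar = A | B | C

definition qint3 :: "'k::field \<Rightarrow> 'k" where
  "qint3 q = q^2 + 1 + inverse q ^ 2"

definition onsager_rels :: "'k::field \<Rightarrow> (ovar, 'k) free_alg set" where
  "onsager_rels q =
    (let x = gen X; y = gen Y; t = scal (qint3 q);
         d = scal ((q^2 - inverse q ^ 2)^2) in
     { x^3*y - t*x^2*y*x + t*x*y*x^2 - y*x^3 + d*(x*y - y*x),
       y^3*x - t*y^2*x*y + t*y*x*y^2 - x*y^3 + d*(y*x - x*y) })"

definition onsager_ideal :: "'k::field \<Rightarrow> (ovar, 'k) free_alg set" where
  "onsager_ideal q = ideal_gen (onsager_rels q)"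

definition aw_central_elts :: "'k::field \<Rightarrow> (awvar, 'k) free_alg set" where
  "aw_central_elts q =
    (let a = gen A; b = gen B; c = gen C;
         e = scal (inverse (q^2 - inverse q ^ 2)); qq = scal q; qi = scal (inverse q) in
     { a + e * (qq*b*c - qi*c*b),
       b + e * (qq*c*a - qi*a*c),
       c + e * (qq*a*b - qi*b*a) })"

definition aw_rels :: "'k::field \<Rightarrow> (awvar, 'k) free_alg set" where
  "aw_rels q = {z * u - u * z | z u. z \<in> aw_central_elts q}"

definition aw_ideal :: "'k::field \<Rightarrow> (awvar, 'k) free_alg set" where
  "aw_ideal q = ideal_gen (aw_rels q)"

definition phi_gen :: "ovar \<Rightarrow> (awvar, 'k::field) free_alg" where
  "phi_gen v = (case v of X \<Rightarrow> gen A | Y \<Rightarrow> gen B)"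

definition phi_lift :: "(ovar, 'k::field) free_alg \<Rightarrow> (awvar, 'k) free_alg" where
  "phi_lift = subst_hom phi_gen"

text \<open>phi from O = F<X,Y>/I_O to Delta = F<A,B,C>/I_Delta is injective iff
 for every representative p, phi_lift p in I_Delta implies p in I_O.\<close>
definition phi_injective :: "'k::field \<Rightarrow> bool" where
  "phi_injective q \<longleftrightarrow>
     (\<forall>p :: (ovar, 'k) free_alg. phi_lift p \<in> aw_ideal q \<longrightarrow> p \<in> onsager_ideal q)"

end

theory Submission
  imports Defs
begin

text \<open>
  Put \<open>k = q\<^sup>2 + q\<^sup>-\<^sup>2\<close>, \<open>V = [x, y]\<close> and \<open>W = [y\<^sup>2x - kyxy + xy\<^sup>2, x]\<close>. Eliminating \<open>C\<close> from the
  defining relations of \<open>\<Delta>\<close> shows that there \<open>W = mV\<close> with \<open>m\<close> central, hence \<open>WuV = VuW\<close> for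
  every \<open>u\<close>. In \<open>\<O>\<close> this fails for \<open>u = x - k\<close>. The Onsager relations say that \<open>V\<close> is killed by
  \<open>V \<mapsto> x\<^sup>2V - kxVx + Vx\<^sup>2 + (k\<^sup>2 - 4)V\<close> and by the same operator for \<open>y\<close>, and they hold for the upper
  triangular matrices \<open>x = diag(2, k, k, 2) + (2 - k)E\<^sub>2\<^sub>3\<close> and
  \<open>y = diag(2, k, k, k\<^sup>2 - 2) + E\<^sub>1\<^sub>2 + E\<^sub>1\<^sub>3 + E\<^sub>3\<^sub>4\<close>, a module glued from two two-dimensional modules in
  which the ratio \<open>W/V\<close> takes different values. The matrix \<open>x - k\<close> links these two pieces, and the
  (1,4) entry of \<open>WuV - VuW\<close> is nonzero.
\<close>

subsection \<open>Evaluation homomorphisms of the free algebra\<close>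

lemma word_eval_zero: "word_eval f 0 = 1"
  by transfer simp

lemma word_eval_letter: "word_eval f (letter v) = f v"
  by transfer simp

lemma word_eval_add: "word_eval f (u + v) = word_eval f u * word_eval f v"
proof (transfer fixing: f)
  fix u v :: "'b list"
  show "foldr (\<lambda>v acc. f v * acc) (u @ v) 1
      = foldr (\<lambda>v acc. f v * acc) u 1 * foldr (\<lambda>v acc. f v * acc) v 1"
    by (induction u) (simp_all add: mult.assoc)
qed

lemma poly_mapping_single_induct [case_names single add]:
  fixes p :: "'a \<Rightarrow>\<^sub>0 'b::comm_monoid_add"
  assumes single: "\<And>w c. P (Poly_Mapping.single w c)"
    and add: "\<And>p r. P p \<Longrightarrow> P r \<Longrightarrow> P (p + r)"
  shows "P p"
proof (induction p rule: update_induct)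
  case const
  then show ?case
    using single[of _ 0] by simp
next
  case (update p w c)
  have "Poly_Mapping.update w c p = p + Poly_Mapping.single w c"
    using update(1) by (intro poly_mapping_eqI)
      (auto simp: lookup_update lookup_add lookup_single in_keys_iff when_def)
  then show ?case
    using add single update by simp
qed

text \<open>An algebra over the field is encoded as a ring with a central homomorphism
  \<open>\<iota>\<close> from the scalars. This covers both \<open>phi_lift\<close> and the matrix
  representation.\<close>

locale free_alg_eval =
  fixes \<iota> :: "'k::field \<Rightarrow> 'r::ring_1" and f :: "'v \<Rightarrow> 'r"
  assumes scalar_zero: "\<iota> 0 = 0"
    and scalar_one: "\<iota> 1 = 1"
    and scalar_add: "\<iota> (a + b) = \<iota> a + \<iota> b"
    and scalar_mult: "\<iota> (a * b) = \<iota> a * \<iota> b"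
    and scalar_central: "\<iota> a * r = r * \<iota> a"
begin

definition ev :: "('v, 'k) free_alg \<Rightarrow> 'r" where
  "ev p = (\<Sum>w\<in>Poly_Mapping.keys p. \<iota> (Poly_Mapping.lookup p w) * word_eval f w)"

lemma ev_superset:
  assumes "finite S" "Poly_Mapping.keys p \<subseteq> S"
  shows "ev p = (\<Sum>w\<in>S. \<iota> (Poly_Mapping.lookup p w) * word_eval f w)"
  unfolding ev_def
  by (rule sum.mono_neutral_left) (use assms in \<open>auto simp: in_keys_iff scalar_zero\<close>)

lemma ev_zero: "ev 0 = 0"
  by (simp add: ev_def)

lemma ev_add: "ev (p + r) = ev p + ev r"
proof -
  let ?S = "Poly_Mapping.keys p \<union> Poly_Mapping.keys r"
  have "Poly_Mapping.keys (p + r) \<subseteq> ?S"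
    by (rule Poly_Mapping.keys_add)
  then show ?thesis
    by (simp add: ev_superset[of ?S] lookup_add scalar_add algebra_simps sum.distrib)
qed

lemma ev_single: "ev (Poly_Mapping.single w c) = \<iota> c * word_eval f w"
  by (cases "c = 0") (simp_all add: ev_def scalar_zero)

lemma ev_diff: "ev (p - r) = ev p - ev r"
  using ev_add[of "p - r" r] by (simp add: algebra_simps)

lemma ev_single_mult:
  "ev (Poly_Mapping.single w c * p) = ev (Poly_Mapping.single w c) * ev p"
proof (induction p rule: poly_mapping_single_induct)
  case (single v b)
  have "\<iota> c * \<iota> b * (word_eval f w * word_eval f v)
      = \<iota> c * word_eval f w * (\<iota> b * word_eval f v)"
    by (metis mult.assoc scalar_central)
  then show ?case
    by (simp add: mult_single ev_single scalar_mult word_eval_add)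
next
  case (add p1 p2)
  then show ?case
    by (simp add: distrib_left ev_add)
qed

lemma ev_mult: "ev (p * r) = ev p * ev r"
proof (induction p rule: poly_mapping_single_induct)
  case (single v b)
  show ?case by (rule ev_single_mult)
next
  case (add p1 p2)
  then show ?case
    by (simp add: distrib_right ev_add)
qed

lemma ev_gen: "ev (gen v) = f v"
  by (simp add: gen_def ev_single scalar_one word_eval_letter)

lemma ev_scal: "ev (scal c) = \<iota> c"
  by (simp add: scal_def ev_single word_eval_zero)

lemma ev_power: "ev (p ^ n) = ev p ^ n"
  using ev_scal[of 1] by (induction n) (simp_all add: ev_mult scalar_one scal_def)

lemmas ev_simps = ev_zero ev_add ev_diff ev_mult ev_gen ev_scal

lemma ev_ideal_gen:
  assumes "p \<in> ideal_gen S" "\<And>s. s \<in> S \<Longrightarrow> ev s = 0"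
  shows "ev p = 0"
  using assms by (induction rule: ideal_gen.induct) (simp_all add: ev_simps)

end

lemma scal_zero: "scal 0 = 0"
  by (simp add: scal_def)

lemma scal_one: "scal 1 = 1"
  by (simp add: scal_def)

lemma scal_add: "scal (a + b) = scal a + scal b"
  by (simp add: scal_def single_add)

lemma scal_diff: "scal (a - b) = scal a - scal b"
  by (simp add: scal_def single_diff)

lemma scal_mult: "scal (a * b) = scal a * scal b"
  by (simp add: scal_def mult_single)

lemma scal_central: "scal a * p = p * scal a"
  by (induction p rule: poly_mapping_single_induct)
    (simp_all add: scal_def mult_single mult.commute distrib_left distrib_right)

interpretation phi: free_alg_eval "scal :: 'k::field \<Rightarrow> (awvar, 'k) free_alg" phi_gen
  rewrites "free_alg_eval.ev scal phi_gen = (phi_lift :: (ovar, 'k) free_alg \<Rightarrow> _)"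
proof -
  show *: "free_alg_eval (scal :: 'k \<Rightarrow> (awvar, 'k) free_alg)"
    by unfold_locales (fact scal_zero scal_one scal_add scal_mult scal_central)+
  show "free_alg_eval.ev scal phi_gen = (phi_lift :: (ovar, 'k) free_alg \<Rightarrow> _)"
    by (simp add: fun_eq_iff free_alg_eval.ev_def[OF *] phi_lift_def subst_hom_def)
qed

subsection \<open>A kernel element\<close>

text \<open>Since \<open>k\<close> is a ring element, one expression serves both free algebras and
  the matrix ring.\<close>

definition kernel_elt :: "'r::ring_1 \<Rightarrow> 'r \<Rightarrow> 'r \<Rightarrow> 'r" where
  "kernel_elt k x y =
    (let V = x * y - y * x;
         F = y * y * x - k * y * x * y + x * y * y;
         W = F * x - x * F
     in W * (x - k) * V - V * (x - k) * W)"

lemma ideal_gen_mult_left: "a \<in> ideal_gen S \<Longrightarrow> r * a \<in> ideal_gen S"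
  using ideal_gen.mult[of a S r 1] by simp

lemma ideal_gen_mult_right: "a \<in> ideal_gen S \<Longrightarrow> a * r \<in> ideal_gen S"
  using ideal_gen.mult[of a S 1 r] by simp

lemma ideal_gen_diff:
  assumes "a \<in> ideal_gen S" "b \<in> ideal_gen S"
  shows "a - b \<in> ideal_gen S"
  using ideal_gen.add[OF assms(1) ideal_gen_mult_left[OF assms(2), of "-1"]] by simp

text \<open>Here \<open>q\<close>, \<open>i\<close>, \<open>e\<close> play the scalars \<open>q\<close>, \<open>q\<^sup>-\<^sup>1\<close>, \<open>(q\<^sup>2 - q\<^sup>-\<^sup>2)\<^sup>-\<^sup>1\<close>; the difference \<open>W - mV\<close> with
  \<open>m = (q\<^sup>2 - q\<^sup>-\<^sup>2)(q - q\<^sup>-\<^sup>1)z\<close> is written as a combination of commutators with the central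
  elements \<open>z\<close> and \<open>z1\<close>.\<close>

lemma commutator_identity:
  fixes q i e D a b c :: "'r::ring_1"
  assumes central: "\<And>r. r * q = q * r" "\<And>r. r * i = i * r" "\<And>r. r * e = e * r" "\<And>r. r * D = D * r"
    and inv: "q * i = 1" "D * e = 1"
  defines "z \<equiv> c + e * (q * a * b - i * b * a)"
    and "z1 \<equiv> a + e * (q * b * c - i * c * b)"
    and "F \<equiv> b * b * a - (q * q + i * i) * b * a * b + a * b * b"
  shows "F * a - a * F - (D * (q - i) * z) * (a * b - b * a)
    = D * D * (z1 * a - a * z1)
      + D * (q * ((z * b - b * z) * a) - q * (z * (a * b) - a * b * z) + i * ((z * a - a * z) * b))"
proof -
  have cz: "c = z - e * (q * a * b - i * b * a)"
    by (simp add: z_def)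
  have left_commute: "r * (q * s) = q * (r * s)" "r * (i * s) = i * (r * s)"
    "r * (D * s) = D * (r * s)" "r * (e * s) = e * (r * s)" for r s
    by (metis central mult.assoc)+
  \<comment> \<open>Rewriting with these instances only keeps the scalars from being permuted forever.\<close>
  note scalars_left = left_commute[of a] left_commute[of b] left_commute[of z]
    left_commute(3,4)[of q] left_commute(3,4)[of i]
  have "i * q = 1" "e * D = 1"
    using inv central by metis+
  then have cancel: "q * (i * s) = s" "i * (q * s) = s" "D * (e * s) = s" "e * (D * s) = s" for s
    using inv by (metis mult.assoc mult_1_left)+
  \<comment> \<open>Eliminating \<open>c\<close> leaves \<open>F\<close> in
    \<open>D * D * z1\<close>, next to a multiple of \<open>a\<close> and terms in \<open>z\<close>.
    So the commutator with \<open>a\<close> produces \<open>W\<close> up to terms in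
    \<open>z\<close>.\<close>
  have DDz1: "D * D * z1 = D * D * a + D * (q * b * z - i * z * b) + F"
    unfolding z1_def F_def cz
    by (simp add: algebra_simps scalars_left cancel)
  have "D * D * (z1 * a - a * z1) = D * D * z1 * a - a * (D * D * z1)"
    by (simp add: algebra_simps scalars_left)
  also have "\<dots> = F * a - a * F + D * (q * b * z - i * z * b) * a - a * (D * (q * b * z - i * z * b))"
    unfolding DDz1 by (simp add: algebra_simps scalars_left)
  finally show ?thesis
    by (simp add: algebra_simps scalars_left)
qed

lemma q_square_diff_nonzero:
  fixes q :: "'k::field"
  assumes "q \<noteq> 0" "q ^ 4 \<noteq> 1"
  shows "q\<^sup>2 - inverse q ^ 2 \<noteq> 0"
  using assms by (auto simp: field_simps power2_eq_square eval_nat_numeral)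

lemma kernel_elt_in_aw_ideal:
  fixes q :: "'k::field"
  assumes "q \<noteq> 0" "q ^ 4 \<noteq> 1"
  shows "kernel_elt (scal (q\<^sup>2 + inverse q ^ 2)) (gen A) (gen B) \<in> aw_ideal q"
proof -
  let ?D = "q\<^sup>2 - inverse q ^ 2"
  define a b c :: "(awvar, 'k) free_alg" where "a = gen A" and "b = gen B" and "c = gen C"
  define qq i e D :: "(awvar, 'k) free_alg"
    where "qq = scal q" and "i = scal (inverse q)" and "e = scal (inverse ?D)" and "D = scal ?D"
  have inv: "qq * i = 1" "D * e = 1"
    using assms q_square_diff_nonzero[OF assms]
    by (simp_all add: qq_def i_def D_def e_def flip: scal_mult scal_one)
  have central: "r * qq = qq * r" "r * i = i * r" "r * e = e * r" "r * D = D * r" for r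
    by (simp_all add: qq_def i_def e_def D_def scal_central)
  define z z1 V F W where "z = c + e * (qq * a * b - i * b * a)"
    and "z1 = a + e * (qq * b * c - i * c * b)"
    and "V = a * b - b * a"
    and "F = b * b * a - (qq * qq + i * i) * b * a * b + a * b * b"
    and "W = F * a - a * F"
  let ?J = "aw_ideal q" and ?k = "qq * qq + i * i"
  have "z \<in> aw_central_elts q" "z1 \<in> aw_central_elts q"
    by (simp_all add: aw_central_elts_def Let_def z_def z1_def a_def b_def c_def qq_def i_def e_def)
  then have comm: "z * u - u * z \<in> ?J" "z1 * u - u * z1 \<in> ?J" for u
    unfolding aw_ideal_def aw_rels_def by (auto intro!: ideal_gen.base)
  note J_intros = ideal_gen.add[of _ "aw_rels q", folded aw_ideal_def]
    ideal_gen_diff[of _ "aw_rels q", folded aw_ideal_def]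
    ideal_gen_mult_left[of _ "aw_rels q", folded aw_ideal_def]
  have comm_mult: "(z * u - u * z) * v \<in> ?J" for u v
    using comm(1) unfolding aw_ideal_def by (rule ideal_gen_mult_right)
  define N where "N = W - D * (qq - i) * z * V"
  have "N = D * D * (z1 * a - a * z1)
      + D * (qq * ((z * b - b * z) * a) - qq * (z * (a * b) - a * b * z) + i * ((z * a - a * z) * b))"
    unfolding N_def W_def F_def V_def z_def z1_def
    by (rule commutator_identity) (fact central inv)+
  then have N: "N \<in> ?J"
    by (auto intro!: J_intros comm comm_mult)
  have g: "r * (D * (qq - i)) = D * (qq - i) * r" for r
    unfolding D_def qq_def i_def by (metis scal_central scal_diff scal_mult)
  have W: "W = N + D * (qq - i) * z * V"
    by (simp add: N_def)
  have N_mult: "N * r \<in> ?J" for r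
    using N unfolding aw_ideal_def by (rule ideal_gen_mult_right)
  have "W * u * V - V * u * W \<in> ?J" for u
  proof -
    have "V * u * (D * (qq - i) * z * V) = D * (qq - i) * (V * u * z * V)"
      using g[of "V * u"] by (simp add: mult.assoc[symmetric])
    \<comment> \<open>Apart from the terms in \<open>N\<close>, the two products differ only in the
      place of \<open>z\<close>, before or after \<open>V * u\<close>.\<close>
    then have "W * u * V - V * u * W
        = N * (u * V) - (V * u) * N + D * (qq - i) * ((z * (V * u) - V * u * z) * V)"
      unfolding W by (simp add: distrib_left distrib_right left_diff_distrib right_diff_distrib mult.assoc)
    also have "\<dots> \<in> ?J"
      by (rule J_intros N N_mult comm_mult)+
    finally show ?thesis .
  qed
  moreover have "scal (q\<^sup>2 + inverse q ^ 2) = ?k"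
    by (simp add: qq_def i_def scal_add scal_mult power2_eq_square)
  ultimately show ?thesis
    by (simp add: kernel_elt_def Let_def W_def F_def V_def a_def b_def)
qed

subsection \<open>A triangular representation of the q-Onsager algebra\<close>

text \<open>Upper triangular 4 by 4 matrices whose (2,2) and (3,3) entries agree, the common value being \<open>d2\<close>.\<close>

datatype 'a tri = Tri (d1: 'a) (d2: 'a) (d4: 'a) (e12: 'a) (e13: 'a) (e14: 'a) (e23: 'a) (e24: 'a) (e34: 'a)

instantiation tri :: (comm_ring_1) ring_1
begin

definition "0 = Tri 0 0 0 0 0 0 0 0 0"
definition "1 = Tri 1 1 1 0 0 0 0 0 0"
definition "x + y = Tri (d1 x + d1 y) (d2 x + d2 y) (d4 x + d4 y) (e12 x + e12 y) (e13 x + e13 y)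
  (e14 x + e14 y) (e23 x + e23 y) (e24 x + e24 y) (e34 x + e34 y)"
definition "x - y = Tri (d1 x - d1 y) (d2 x - d2 y) (d4 x - d4 y) (e12 x - e12 y) (e13 x - e13 y)
  (e14 x - e14 y) (e23 x - e23 y) (e24 x - e24 y) (e34 x - e34 y)"
definition "- x = Tri (- d1 x) (- d2 x) (- d4 x) (- e12 x) (- e13 x)
  (- e14 x) (- e23 x) (- e24 x) (- e34 x)"
definition "x * y = Tri (d1 x * d1 y) (d2 x * d2 y) (d4 x * d4 y)
  (d1 x * e12 y + e12 x * d2 y)
  (d1 x * e13 y + e12 x * e23 y + e13 x * d2 y)
  (d1 x * e14 y + e12 x * e24 y + e13 x * e34 y + e14 x * d4 y)
  (d2 x * e23 y + e23 x * d2 y)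
  (d2 x * e24 y + e23 x * e34 y + e24 x * d4 y)
  (d2 x * e34 y + e34 x * d4 y)"

instance
  by standard
    (simp_all add: zero_tri_def one_tri_def plus_tri_def minus_tri_def uminus_tri_def times_tri_def
      algebra_simps)

end

lemmas tri_defs = zero_tri_def one_tri_def plus_tri_def minus_tri_def uminus_tri_def times_tri_def

definition tri_scalar :: "'a::comm_ring_1 \<Rightarrow> 'a tri" where
  "tri_scalar c = Tri c c c 0 0 0 0 0 0"

text \<open>For \<open>k = q^2 + q^-2\<close> the diagonal entries 2, k, k^2 - 2 are q^(2j) +
  q^(-2j) with j = 0, 1, 2. Consecutive values s, t satisfy s^2 - kst + t^2 + k^2 - 4 = 0, so the
  two operators kill the (1,2) and (3,4) entries of V. The entry \<open>2 - k\<close> makes V13 and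
  V24 + V34 vanish, which settles the (1,4) entry.\<close>

definition tri_rep :: "'a::comm_ring_1 \<Rightarrow> ovar \<Rightarrow> 'a tri" where
  "tri_rep k v = (case v of
      X \<Rightarrow> Tri 2 k 2 0 0 0 (2 - k) 0 0
    | Y \<Rightarrow> Tri 2 k (k\<^sup>2 - 2) 1 1 0 0 0 1)"

interpretation tri: free_alg_eval tri_scalar "tri_rep k" for k :: "'k::field"
  by unfold_locales (simp_all add: tri_scalar_def tri_defs algebra_simps)

lemma onsager_relations_tri_rep:
  fixes k :: "'a::comm_ring_1"
  defines "x \<equiv> tri_rep k X" and "y \<equiv> tri_rep k Y" and "t \<equiv> tri_scalar (k + 1)"
    and "d \<equiv> tri_scalar (k\<^sup>2 - 4)"
  shows "x^3*y - t*x^2*y*x + t*x*y*x^2 - y*x^3 + d*(x*y - y*x) = 0"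
    and "y^3*x - t*y^2*x*y + t*y*x*y^2 - x*y^3 + d*(y*x - x*y) = 0"
  unfolding x_def y_def t_def d_def
  by (simp_all add: tri_rep_def tri_scalar_def tri_defs power2_eq_square power3_eq_cube algebra_simps)

text \<open>V and W are strictly upper triangular and the middle block of x - k is (2 - k)E23, so
  the entry is (2 - k)(W12 V34 - V12 W34). Here V12 = 2 - k and V34 = k - 2, and the ratios W12/V12
  and W34/V34 differ by (k - 2)(4 - k^2).\<close>

lemma kernel_elt_tri_rep:
  fixes k :: "'a::comm_ring_1"
  shows "e14 (kernel_elt (tri_scalar k) (tri_rep k X) (tri_rep k Y)) = (k - 2)^4 * (4 - k\<^sup>2)"
  by (simp add: kernel_elt_def Let_def tri_rep_def tri_scalar_def tri_defs power2_eq_square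
     eval_nat_numeral algebra_simps)

lemma kernel_elt_notin_onsager_ideal:
  fixes q :: "'k::field"
  assumes "q \<noteq> 0" "q ^ 4 \<noteq> 1"
  shows "kernel_elt (scal (q\<^sup>2 + inverse q ^ 2)) (gen X) (gen Y) \<notin> onsager_ideal q"
proof
  let ?k = "q\<^sup>2 + inverse q ^ 2"
  assume mem: "kernel_elt (scal ?k) (gen X) (gen Y) \<in> onsager_ideal q"
  have "qint3 q = ?k + 1"
    by (simp add: qint3_def)
  moreover have disc: "(q\<^sup>2 - inverse q ^ 2)\<^sup>2 = ?k\<^sup>2 - 4"
    using assms(1) by (simp add: field_simps power2_eq_square)
  ultimately have "tri.ev ?k s = 0" if "s \<in> onsager_rels q" for s
    using that onsager_relations_tri_rep[of ?k]
    by (auto simp only: onsager_rels_def Let_def insert_iff empty_iff tri.ev_simps tri.ev_power)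
  with mem have "tri.ev ?k (kernel_elt (scal ?k) (gen X) (gen Y)) = 0"
    unfolding onsager_ideal_def by (rule tri.ev_ideal_gen)
  then have "kernel_elt (tri_scalar ?k) (tri_rep ?k X) (tri_rep ?k Y) = 0"
    by (simp add: kernel_elt_def Let_def tri.ev_simps)
  then have "(?k - 2)^4 * (4 - ?k\<^sup>2) = 0"
    by (metis kernel_elt_tri_rep tri.sel(6) zero_tri_def)
  \<comment> \<open>Thus k = 2 also forces k^2 = 4, and either vanishing factor contradicts q^4
    being different from 1.\<close>
  moreover have "?k\<^sup>2 - 4 = (?k - 2) * (?k + 2)"
    by (simp add: algebra_simps power2_eq_square)
  ultimately have "(q\<^sup>2 - inverse q ^ 2)\<^sup>2 = 0"
    unfolding disc by auto
  then show False
    using q_square_diff_nonzero[OF assms] by simp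
qed

theorem theorem10p9:
  fixes q :: "'k::field"
  assumes "q \<noteq> 0" and "q ^ 4 \<noteq> 1"
  shows "\<not> phi_injective q"
proof -
  let ?k = "q\<^sup>2 + inverse q ^ 2"
  have "phi_lift (kernel_elt (scal ?k) (gen X) (gen Y)) = kernel_elt (scal ?k) (gen A) (gen B)"
    by (simp add: kernel_elt_def Let_def phi.ev_simps phi_gen_def)
  then show ?thesis
    using kernel_elt_in_aw_ideal[OF assms] kernel_elt_notin_onsager_ideal[OF assms]
    unfolding phi_injective_def by metis
qed

end
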